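(* Let $d \ge 0$ be an integer and define $f(d) = \lfloor \frac{3d}{2} \rfloor + 1$. (a) Let $K_1, K_2, K_3 \subset \mathbb{R}^d$ be convex sets, and let $S$ be the set of all points of $\mathbb{R}^d$ that are encapsulated by $K_1, K_2, K_3$. Then $|S| \le f(d)$. (b) With $K_1,K_2,K_3$ and $S$ as in (a), if $|S| = f(d)$ then the sets $K_1, K_2, K_3$ are pairwise disjoint. (c) There exist convex sets $K_1, K_2, K_3 \subset \mathbb{R}^d$ such that, denoting by $S$ the set of points of $\mathbb{R}^d$ encapsulated by $K_1,K_2,K_3$, one has $|S| = f(d)$ and $\mathbb{R}^d \setminus (K_1 \cup K_2 \cup K_3) = S$.
   Context: A point $p \in \mathbb{R}^d$ is encapsulated by the convex sets $K_1, \ldots, K_n \subset \mathbb{R}^d$ if for some $\epsilon > 0$, $B(p,\epsilon) \setminus (\bigcup_{i=1}^n K_i) = \{p\}$, where $B(p,\epsilon)$ is the open ball of radius $\epsilon$ centered at $p$. The sets $K_i$ are arbitrary convex sets (not assumed open, closed, bounded or nonempty). $\mathbb{R}^0$ is a single point. *)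

theory Defs
  imports "HOL-Analysis.Analysis"
begin

(* The class euclidean_space has no instance of dimension 0. To cover every d >= 0 uniformly,
   R^d is therefore rendered as a d-dimensional linear subspace V of an arbitrary Euclidean
   space, with the inherited metric and linear structure: V = UNIV is the full space and
   V = {0} is R^0. All subspaces of the same dimension are linearly isometric
   (isometry_subspaces), so the choice of V is immaterial. The open ball of V
   around p is ball p e Int V. *)

definition encapsulated :: "'a::euclidean_space set \<Rightarrow> nat \<Rightarrow> (nat \<Rightarrow> 'a set) \<Rightarrow> 'a \<Rightarrow> bool"
  where "encapsulated V n K p \<longleftrightarrow>
    p \<in> V \<and> (\<exists>\<epsilon>>0. (ball p \<epsilon> \<inter> V) - (\<Union>i\<in>{1..n}. K i) = {p})"

definition encapsulated_points :: "'a::euclidean_space set \<Rightarrow> nat \<Rightarrow> (nat \<Rightarrow> 'a set) \<Rightarrow> 'a set"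
  where "encapsulated_points V n K = {p. encapsulated V n K p}"

definition max_encapsulated :: "nat \<Rightarrow> nat"
  where "max_encapsulated d = (3 * d) div 2 + 1"

definition convex_sets_in :: "'a::euclidean_space set \<Rightarrow> nat \<Rightarrow> (nat \<Rightarrow> 'a set) \<Rightarrow> bool"
  where "convex_sets_in V n K \<longleftrightarrow> (\<forall>i\<in>{1..n}. convex (K i) \<and> K i \<subseteq> V)"

end

theory Submission
  imports Defs
begin

text \<open>
  Upper bound. Call \<open>p \<in> S\<close> \<^emph>\<open>unadjacent\<close> to \<open>K i\<close> if it is not in the closure of \<open>K i\<close>. Near such a
  point only the other two sets matter, and restricting to the line through two such points shows
  that there is at most one for each \<open>i\<close>; let \<open>E\<close> be the set of these at most three points.
  The three supporting half-spaces at any \<open>p \<in> S\<close> cover the space, so their normals are positively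
  dependent, and \<open>S - E\<close> lies in the common boundary of the half-spaces with positive weight, a proper
  flat through \<open>p\<close>. Either one such flat contains all of \<open>S\<close>, or two of them meet in codimension at
  least 2, which gives \<open>card S \<le> 3 + f (d - 2)\<close>. If \<open>K i\<close> and \<open>K j\<close> share a point \<open>x\<close>, then every
  \<open>p \<in> S\<close> is approached by the third set along the ray from \<open>x\<close> beyond \<open>p\<close>, so \<open>card E \<le> 2\<close>.

  Construction. From \<open>W\<close> to \<open>V = W \<oplus> \<real>\<^sup>2\<close>, take the three sectors of a tropical line in
  \<open>\<real>\<^sup>2\<close>, times \<open>W\<close>, and cut each of the three separating half-flats into two convex pieces and one
  new point, along a lexicographic refinement of the cut that separates the old sets in \<open>W\<close>.
\<close>

section \<open>The upper bound\<close>

lemma atLeastAtMost_1_3: "{1..3} = {1, 2, 3::nat}" "{Suc 0..3} = {1, 2, 3::nat}"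
  by auto

lemma encapsulated_altdef:
  "encapsulated A n K p \<longleftrightarrow>
    p \<in> A \<and> (\<forall>i\<in>{1..n}. p \<notin> K i) \<and>
    (\<exists>\<epsilon>>0. \<forall>x\<in>A. x \<noteq> p \<longrightarrow> dist p x < \<epsilon> \<longrightarrow> (\<exists>i\<in>{1..n}. x \<in> K i))"
  (is "?L \<longleftrightarrow> ?R")
proof
  assume ?L
  then obtain e where e: "e > 0" "ball p e \<inter> A - (\<Union>i\<in>{1..n}. K i) = {p}"
    unfolding encapsulated_def by blast
  have "p \<in> A" "\<forall>i\<in>{1..n}. p \<notin> K i"
    using e(2) by blast+
  moreover have "\<forall>x\<in>A. x \<noteq> p \<longrightarrow> dist p x < e \<longrightarrow> (\<exists>i\<in>{1..n}. x \<in> K i)"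
  proof (intro ballI impI)
    fix x assume "x \<in> A" "x \<noteq> p" "dist p x < e"
    then have "x \<in> ball p e \<inter> A" "x \<notin> {p}" by auto
    then show "\<exists>i\<in>{1..n}. x \<in> K i" unfolding e(2)[symmetric] by blast
  qed
  ultimately show ?R using e(1) by blast
next
  assume R: ?R
  then obtain e where e: "e > 0"
    "\<forall>x\<in>A. x \<noteq> p \<longrightarrow> dist p x < e \<longrightarrow> (\<exists>i\<in>{1..n}. x \<in> K i)" by blast
  have "ball p e \<inter> A - (\<Union>i\<in>{1..n}. K i) = {p}"
    using R e by auto
  with R e(1) show ?L unfolding encapsulated_def by blast
qed

lemma encapsulated_subset:
  assumes "encapsulated A n K p" "p \<in> B" "B \<subseteq> A"
  shows "encapsulated B n K p"
  using assms unfolding encapsulated_altdef by blast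

text \<open>Restricting to a subset of the ambient set keeps encapsulation with the same sets
  \<open>K i\<close>. The induction on dimension can therefore fix \<open>K\<close> and vary only
  the ambient flat.\<close>

lemma encapsulated_points_Int:
  "B \<subseteq> A \<Longrightarrow> encapsulated_points A n K \<inter> B \<subseteq> encapsulated_points B n K"
  unfolding encapsulated_points_def using encapsulated_subset by blast

lemma encapsulated_pointsD:
  assumes "p \<in> encapsulated_points A n K"
  shows "p \<in> A" "i \<in> {1..n} \<Longrightarrow> p \<notin> K i"
  using assms unfolding encapsulated_points_def encapsulated_altdef by auto

lemma affine_diff_mem:
  fixes a b c :: "'a::real_vector"
  assumes "affine A" "a \<in> A" "b \<in> A" "c \<in> A"
  shows "a + t *\<^sub>R (b - c) \<in> A"
proof -
  have "1 *\<^sub>R a + t *\<^sub>R (b - c) \<in> A"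
    using mem_affine_3_minus[OF assms, of t] by simp
  then show ?thesis by simp
qed

text \<open>Eventualities in \<open>at_right 0\<close> can be conjoined, so finitely many directions
  at finitely many encapsulated points can share one small \<open>t\<close>.\<close>

lemma encapsulated_direction:
  assumes p: "p \<in> encapsulated_points A n K" and v: "v \<noteq> 0" "\<And>t. p + t *\<^sub>R v \<in> A"
  shows "\<forall>\<^sub>F t in at_right 0. \<exists>i\<in>{1..n}. p + t *\<^sub>R v \<in> K i"
proof -
  obtain e where e: "e > 0"
    "\<forall>x\<in>A. x \<noteq> p \<longrightarrow> dist p x < e \<longrightarrow> (\<exists>i\<in>{1..n}. x \<in> K i)"
    using p unfolding encapsulated_points_def encapsulated_altdef by blast
  show ?thesis unfolding eventually_at_right_field
  proof (intro exI[of _ "e / norm v"] conjI allI impI)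
    show "0 < e / norm v" using e v by simp
    fix t :: real assume t: "0 < t" "t < e / norm v"
    have "dist p (p + t *\<^sub>R v) < e"
      using t v(1) by (simp add: dist_norm pos_less_divide_eq)
    moreover have "p + t *\<^sub>R v \<noteq> p" using t v by simp
    ultimately show "\<exists>i\<in>{1..n}. p + t *\<^sub>R v \<in> K i" using e(2) v(2) by blast
  qed
qed

section \<open>Points unadjacent to one of the sets\<close>

text \<open>The closure is that of \<open>K i \<inter> A\<close> because \<open>K i\<close> may
  leave \<open>A\<close> and approach a point of \<open>A\<close> only from outside.\<close>

definition unadjacent_points :: "'a::euclidean_space set \<Rightarrow> (nat \<Rightarrow> 'a set) \<Rightarrow> nat \<Rightarrow> 'a set"
  where "unadjacent_points A K i = encapsulated_points A 3 K - closure (K i \<inter> A)"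

lemma unadjacent_direction:
  assumes p: "p \<in> unadjacent_points A K k" and v: "v \<noteq> 0" "\<And>t. p + t *\<^sub>R v \<in> A"
  shows "\<forall>\<^sub>F t in at_right 0. \<exists>i\<in>{1..3}-{k}. p + t *\<^sub>R v \<in> K i"
proof -
  have "((\<lambda>t. p + t *\<^sub>R v) \<longlongrightarrow> p + 0 *\<^sub>R v) (at_right 0)"
    by (intro tendsto_intros)
  moreover have "open (- closure (K k \<inter> A))" "p + 0 *\<^sub>R v \<in> - closure (K k \<inter> A)"
    using p by (auto simp: unadjacent_points_def)
  ultimately have "\<forall>\<^sub>F t in at_right 0. p + t *\<^sub>R v \<in> - closure (K k \<inter> A)"
    using topological_tendstoD by blast
  then have "\<forall>\<^sub>F t in at_right 0. p + t *\<^sub>R v \<notin> K k"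
    by eventually_elim (use v(2) closure_subset in blast)
  moreover have "\<forall>\<^sub>F t in at_right 0. \<exists>i\<in>{1..3}. p + t *\<^sub>R v \<in> K i"
    using encapsulated_direction[OF _ v] p by (auto simp: unadjacent_points_def)
  ultimately show ?thesis by eventually_elim auto
qed

lemma convex_line:
  fixes p v :: "'a::real_vector"
  assumes "convex C" "p + s *\<^sub>R v \<in> C" "p + u *\<^sub>R v \<in> C" "s \<le> m" "m \<le> u"
  shows "p + m *\<^sub>R v \<in> C"
proof (cases "s = u")
  case False
  with assms have su: "s < u" by simp
  define w where "w = (m - s) / (u - s)"
  have "w * (u - s) = m - s" using su by (simp add: w_def)
  then have "(1 - w) * s + w * u = m" by (simp add: algebra_simps)
  moreover have "0 \<le> w" "w \<le> 1" using assms su by (auto simp: w_def)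
  ultimately have w: "0 \<le> w" "w \<le> 1" "(1 - w) * s + w * u = m" by auto
  have "(1 - w) *\<^sub>R (p + s *\<^sub>R v) + w *\<^sub>R (p + u *\<^sub>R v) \<in> C"
    using assms(1-3) w by (intro convexD) auto
  also have "(1 - w) *\<^sub>R (p + s *\<^sub>R v) + w *\<^sub>R (p + u *\<^sub>R v) = p + ((1 - w) * s + w * u) *\<^sub>R v"
    by (simp add: algebra_simps)
  finally show ?thesis using w by simp
qed (use assms in auto)

lemma eventually_at_right_0_ex: "\<forall>\<^sub>F t in at_right (0::real). P t \<Longrightarrow> \<exists>t>0. P t"
  unfolding eventually_at_right_field using dense by blast

lemma at_right_0_less: "0 < c \<Longrightarrow> \<forall>\<^sub>F t in at_right (0::real). t < c"
  by (rule eventually_at_right_real[THEN eventually_mono]) auto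

text \<open>On the line through \<open>p\<close> and \<open>q\<close>, take points just before
  \<open>p\<close>, just before \<open>q\<close> and just after \<open>q\<close>. Any two of them
  have \<open>p\<close> or \<open>q\<close> between them, which lies in no set, so by convexity they
  need three different sets. Only two indices other than \<open>k\<close> exist.\<close>

lemma unadjacent_points_unique:
  assumes A: "affine A" and K: "\<forall>i\<in>{1..3}. convex (K i)" and k: "k \<in> {1..3}"
    and p: "p \<in> unadjacent_points A K k" and q: "q \<in> unadjacent_points A K k"
  shows "p = q"
proof (rule ccontr)
  assume "p \<noteq> q"
  define v where "v = q - p"
  have v: "v \<noteq> 0" "- v \<noteq> 0" using \<open>p \<noteq> q\<close> by (auto simp: v_def)
  have pq: "p \<in> A" "q \<in> A" "p \<in> encapsulated_points A 3 K" "q \<in> encapsulated_points A 3 K"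
    using p q encapsulated_pointsD by (auto simp: unadjacent_points_def)
  have mem: "x + t *\<^sub>R v \<in> A" "x + t *\<^sub>R (- v) \<in> A" if "x \<in> A" for x t
    using affine_diff_mem[OF A that pq(2,1), of t] affine_diff_mem[OF A that pq(1,2), of t]
    by (auto simp: v_def)
  define P where "P s \<longleftrightarrow> (\<exists>i\<in>{1..3}-{k}. p + s *\<^sub>R v \<in> K i)" for s
  have ev: "\<forall>\<^sub>F t in at_right 0. P t" "\<forall>\<^sub>F t in at_right 0. P (- t)"
    "\<forall>\<^sub>F t in at_right 0. P (1 + t)" "\<forall>\<^sub>F t in at_right 0. P (1 - t)"
    "\<forall>\<^sub>F t in at_right 0. t < (1::real)" "\<forall>\<^sub>F t in at_right 0. 0 < (t::real)"
    using unadjacent_direction[OF p v(1) mem(1)] unadjacent_direction[OF p v(2) mem(2)]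
      unadjacent_direction[OF q v(1) mem(1)] unadjacent_direction[OF q v(2) mem(2)] pq
    by (auto simp: P_def v_def algebra_simps at_right_0_less eventually_at_right_less)
  have "\<forall>\<^sub>F t in at_right 0. P t \<and> P (- t) \<and> P (1 + t) \<and> P (1 - t) \<and> t < 1 \<and> 0 < t"
    using ev by eventually_elim auto
  then obtain t where t: "P t" "P (- t)" "P (1 + t)" "P (1 - t)" "t < 1" "0 < t"
    using eventually_happens' trivial_limit_at_right_real by fastforce
  have no: "\<not> (p + s *\<^sub>R v \<in> K i \<and> p + u *\<^sub>R v \<in> K i)"
    if "i \<in> {1..3}" "s \<le> m" "m \<le> u" "m = 0 \<or> m = 1" for i s u m
    using convex_line[OF bspec[OF K that(1)], of p s v u m] that encapsulated_pointsD(2)[OF pq(3), of i]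
      encapsulated_pointsD(2)[OF pq(4), of i] by (auto simp: v_def)
  obtain i where i: "i \<in> {1..3} - {k}" "p + (- t) *\<^sub>R v \<in> K i" using t(2) unfolding P_def by blast
  obtain j where j: "j \<in> {1..3} - {k}" "p + (1 - t) *\<^sub>R v \<in> K j" using t(4) unfolding P_def by blast
  obtain l where l: "l \<in> {1..3} - {k}" "p + (1 + t) *\<^sub>R v \<in> K l" using t(3) unfolding P_def by blast
  have "i \<noteq> j" using no[of i "-t" 0 "1-t"] i j t by auto
  moreover have "i \<noteq> l" using no[of i "-t" 0 "1+t"] i l t by auto
  moreover have "j \<noteq> l" using no[of j "1-t" 1 "1+t"] l j t by auto
  ultimately show False using i(1) j(1) l(1) k by (auto simp: atLeastAtMost_1_3)
qed

lemma card_unadjacent_points: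
  assumes A: "affine A" and K: "\<forall>i\<in>{1..3}. convex (K i)"
  shows "finite (\<Union>i\<in>{1..3}. unadjacent_points A K i)"
    and "J \<subseteq> {1..3} \<Longrightarrow> card (\<Union>i\<in>J. unadjacent_points A K i) \<le> card J"
proof -
  have 1: "finite (unadjacent_points A K i) \<and> card (unadjacent_points A K i) \<le> 1" if "i \<in> {1..3}" for i
  proof -
    have "\<exists>p. unadjacent_points A K i \<subseteq> {p}"
      using unadjacent_points_unique[OF A K that] by blast
    then show ?thesis using card_mono[of "{_}"] finite_subset by fastforce
  qed
  then show "finite (\<Union>i\<in>{1..3}. unadjacent_points A K i)" by blast
  show "card (\<Union>i\<in>J. unadjacent_points A K i) \<le> card J" if "J \<subseteq> {1..3}"
  proof -
    have "finite J" using that finite_subset by blast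
    then have "card (\<Union>i\<in>J. unadjacent_points A K i) \<le> (\<Sum>i\<in>J. card (unadjacent_points A K i))"
      by (rule card_UN_le)
    also have "\<dots> \<le> (\<Sum>i\<in>J. 1)" using 1 that by (intro sum_mono) blast
    finally show ?thesis by simp
  qed
qed

section \<open>Three encapsulated points on a line\<close>

text \<open>The same count with one more separator: points just before \<open>p\<close>,
  \<open>q\<close> and \<open>r\<close> and just after \<open>r\<close> would need four different
  sets.\<close>

lemma no_three_between:
  assumes A: "affine A" and K: "\<forall>i\<in>{1..3}. convex (K i)"
    and S: "p \<in> encapsulated_points A 3 K" "q \<in> encapsulated_points A 3 K" "r \<in> encapsulated_points A 3 K"
    and d: "p \<noteq> q" "q \<noteq> r" "p \<noteq> r" and b: "between (p, r) q"
  shows False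
proof -
  define v where "v = r - p"
  have v: "v \<noteq> 0" "- v \<noteq> 0" using d by (auto simp: v_def)
  obtain s where s: "0 \<le> s" "s \<le> 1" "q = p + s *\<^sub>R v"
    using b by (auto simp: between_mem_segment in_segment v_def algebra_simps)
  with d have s01: "0 < s" "s < 1" by (auto simp: v_def less_le)
  have pq: "p \<in> A" "q \<in> A" "r \<in> A"
    using S encapsulated_pointsD by blast+
  have mem: "x + t *\<^sub>R v \<in> A" "x + t *\<^sub>R (- v) \<in> A" if "x \<in> A" for x t
    using affine_diff_mem[OF A that pq(3,1), of t] affine_diff_mem[OF A that pq(1,3), of t]
    by (auto simp: v_def)
  define P where "P s \<longleftrightarrow> (\<exists>i\<in>{1..3}. p + s *\<^sub>R v \<in> K i)" for s
  have ev: "\<forall>\<^sub>F t in at_right 0. P (- t)"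
    "\<forall>\<^sub>F t in at_right 0. P (s - t)"
    "\<forall>\<^sub>F t in at_right 0. P (1 + t)" "\<forall>\<^sub>F t in at_right 0. P (1 - t)"
    "\<forall>\<^sub>F t in at_right 0. t < min s (1 - s)"
    "\<forall>\<^sub>F t in at_right 0. 0 < (t::real)"
    using encapsulated_direction[OF S(1) v(2) mem(2)]
      encapsulated_direction[OF S(2) v(2) mem(2)]
      encapsulated_direction[OF S(3) v(1) mem(1)] encapsulated_direction[OF S(3) v(2) mem(2)] pq s01
    by (auto simp: P_def v_def s(3) algebra_simps eventually_at_right_less intro!: at_right_0_less simp del: min_less_iff_conj)
  have "\<forall>\<^sub>F t in at_right 0. P (- t) \<and> P (s - t) \<and> P (1 + t) \<and> P (1 - t) \<and> t < min s (1 - s) \<and> 0 < t"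
    using ev by eventually_elim auto
  then obtain t where t: "P (- t)" "P (s - t)" "P (1 + t)" "P (1 - t)"
    "t < s" "t < 1 - s" "0 < t"
    using eventually_happens' trivial_limit_at_right_real by fastforce
  have no: "\<not> (p + x *\<^sub>R v \<in> K i \<and> p + u *\<^sub>R v \<in> K i)"
    if "i \<in> {1..3}" "x \<le> m" "m \<le> u" "m = 0 \<or> m = s \<or> m = 1" for i x u m
    using convex_line[OF bspec[OF K that(1)], of p x v u m] that encapsulated_pointsD(2)[OF S(1), of i]
      encapsulated_pointsD(2)[OF S(2), of i] encapsulated_pointsD(2)[OF S(3), of i]
    by (auto simp: v_def s(3))
  obtain i1 where i1: "i1 \<in> {1..3}" "p + (- t) *\<^sub>R v \<in> K i1" using t(1) unfolding P_def by blast
  obtain i2 where i2: "i2 \<in> {1..3}" "p + (s - t) *\<^sub>R v \<in> K i2" using t(2) unfolding P_def by blast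
  obtain i4 where i4: "i4 \<in> {1..3}" "p + (1 - t) *\<^sub>R v \<in> K i4" using t(4) unfolding P_def by blast
  obtain i5 where i5: "i5 \<in> {1..3}" "p + (1 + t) *\<^sub>R v \<in> K i5" using t(3) unfolding P_def by blast
  have "i1 \<noteq> i2" using no[of i1 "-t" 0 "s-t"] i1 i2 t by auto
  moreover have "i1 \<noteq> i4" using no[of i1 "-t" 0 "1-t"] i1 i4 t s01 by auto
  moreover have "i1 \<noteq> i5" using no[of i1 "-t" 0 "1+t"] i1 i5 t by auto
  moreover have "i2 \<noteq> i4" using no[of i2 "s-t" s "1-t"] i2 i4 t by auto
  moreover have "i2 \<noteq> i5" using no[of i2 "s-t" s "1+t"] i2 i5 t s01 by auto
  moreover have "i4 \<noteq> i5" using no[of i4 "1-t" 1 "1+t"] i4 i5 t by auto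
  ultimately have "card {i1, i2, i4, i5} = 4" by auto
  moreover have "card {i1, i2, i4, i5} \<le> card {1..3::nat}"
    using i1(1) i2(1) i4(1) i5(1) by (intro card_mono) auto
  ultimately show False by simp
qed

section \<open>Two sets with a common point\<close>

text \<open>A point of \<open>K i\<close> or \<open>K j\<close> beyond \<open>p\<close>, seen from
  \<open>x\<close>, would put \<open>p\<close> on a segment inside that set. Only \<open>K k\<close>
  is left to cover the ray there.\<close>

lemma common_point_direction:
  assumes A: "affine A" and K: "\<forall>i\<in>{1..3}. convex (K i)"
    and ijk: "{i, j, k} = {1..3::nat}" and x: "x \<in> A" "x \<in> K i" "x \<in> K j"
    and p: "p \<in> encapsulated_points A 3 K"
  shows "\<forall>\<^sub>F t in at_right 0. p + t *\<^sub>R (p - x) \<in> K k"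
proof -
  have ij: "i \<in> {1..3}" "j \<in> {1..3}" using ijk by blast+
  have pA: "p \<in> A" "p \<notin> K i" "p \<notin> K j" using p encapsulated_pointsD ij by blast+
  have no: "p + t *\<^sub>R (p - x) \<notin> K l" if "l \<in> {i, j}" "t > 0" for t l
    using convex_line[of "K l" p "-1" "p - x" t 0] K that x pA ij by auto
  have "\<forall>\<^sub>F t in at_right 0. \<exists>i\<in>{1..3}. p + t *\<^sub>R (p - x) \<in> K i"
    using affine_diff_mem[OF A pA(1) pA(1) x(1)] pA x by (intro encapsulated_direction[OF p]) auto
  moreover have "\<forall>\<^sub>F t in at_right 0. 0 < (t::real)" by (rule eventually_at_right_less)
  ultimately show ?thesis
  proof eventually_elim
    case (elim t)
    then obtain l where l: "l \<in> {1..3}" "p + t *\<^sub>R (p - x) \<in> K l" by blast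
    have "l \<in> {i, j, k}" using l(1) ijk by simp
    moreover have "l \<notin> {i, j}" using no[of l t] l(2) elim(2) by blast
    ultimately show ?case using l(2) by auto
  qed
qed

lemma common_point_unadjacent:
  assumes A: "affine A" and K: "\<forall>i\<in>{1..3}. convex (K i)"
    and ijk: "{i, j, k} = {1..3::nat}" and x: "x \<in> A" "x \<in> K i" "x \<in> K j"
  shows "unadjacent_points A K k = {}"
proof (rule ccontr)
  assume "unadjacent_points A K k \<noteq> {}"
  then obtain p where p: "p \<in> unadjacent_points A K k" by blast
  then have pS: "p \<in> encapsulated_points A 3 K" and pcl: "p \<notin> closure (K k \<inter> A)"
    by (auto simp: unadjacent_points_def)
  have pA: "p \<in> A" using pS encapsulated_pointsD by blast
  have "\<forall>\<^sub>F t in at_right 0. p + t *\<^sub>R (p - x) \<in> K k"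
    by (rule common_point_direction[OF A K ijk x pS])
  then have "\<forall>\<^sub>F t in at_right 0. p + t *\<^sub>R (p - x) \<in> closure (K k \<inter> A)"
    by eventually_elim (use affine_diff_mem[OF A pA pA x(1)] closure_subset in blast)
  moreover have "((\<lambda>t. p + t *\<^sub>R (p - x)) \<longlongrightarrow> p + 0 *\<^sub>R (p - x)) (at_right 0)"
    by (intro tendsto_intros)
  ultimately have "p + 0 *\<^sub>R (p - x) \<in> closure (K k \<inter> A)"
    by (intro Lim_in_closed_set[of _ _ "at_right 0"]) auto
  then show False using pcl by simp
qed

text \<open>This gives the strict bound on a line. The set \<open>K k\<close> occurs just beyond
  \<open>p\<close> and just beyond \<open>q\<close>, both seen from \<open>x\<close>; in every order
  of the three points, \<open>p\<close> or \<open>q\<close> separates these two points of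
  \<open>K k\<close>.\<close>

lemma common_point_collinear:
  assumes A: "affine A" and K: "\<forall>i\<in>{1..3}. convex (K i)"
    and ijk: "{i, j, k} = {1..3::nat}" and x: "x \<in> A" "x \<in> K i" "x \<in> K j"
    and col: "collinear A"
    and p: "p \<in> encapsulated_points A 3 K" and q: "q \<in> encapsulated_points A 3 K"
  shows "p = q"
proof (rule ccontr)
  assume "p \<noteq> q"
  have "i \<in> {1..3}" "k \<in> {1..3}" using ijk by blast+
  then have pq: "p \<in> A" "q \<in> A" "p \<noteq> x" "q \<noteq> x" "p \<notin> K k" "q \<notin> K k"
    using p q x encapsulated_pointsD by blast+
  define v where "v = q - x"
  have "{q, p, x} \<subseteq> A" using pq x by simp
  then have "collinear {q, p, x}" using col collinear_subset by metis
  then obtain a where "p = a *\<^sub>R q + (1 - a) *\<^sub>R x"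
    using pq(4) unfolding collinear_3_expand by metis
  then have a: "p = x + a *\<^sub>R v" by (simp add: v_def algebra_simps)
  have a01: "a \<noteq> 0" "a \<noteq> 1" using a pq \<open>p \<noteq> q\<close> by (auto simp: v_def)
  have "\<forall>\<^sub>F t in at_right 0. x + (a + t * a) *\<^sub>R v \<in> K k"
    using common_point_direction[OF A K ijk x p] by (simp add: a algebra_simps)
  moreover have "\<forall>\<^sub>F t in at_right 0. x + (1 + t) *\<^sub>R v \<in> K k"
    using common_point_direction[OF A K ijk x q] by (simp add: v_def algebra_simps)
  moreover have "\<forall>\<^sub>F t in at_right 0. 0 < (t::real)" by (rule eventually_at_right_less)
  \<comment> \<open>Of \<open>p\<close> and \<open>q\<close> on the same side of \<open>x\<close>,
    the sample beyond the nearer one must not pass the farther one. This bound ensures it for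
    \<open>1 < a\<close>, the next one for \<open>0 < a < 1\<close>.\<close>
  moreover have "\<forall>\<^sub>F t in at_right 0. t < \<bar>a - 1\<bar>" using a01 by (intro at_right_0_less) auto
  moreover have "\<forall>\<^sub>F t in at_right 0. t < \<bar>(1 - a) / a\<bar>" using a01 by (intro at_right_0_less) auto
  ultimately have "\<forall>\<^sub>F t in at_right 0. x + (a + t * a) *\<^sub>R v \<in> K k \<and> x + (1 + t) *\<^sub>R v \<in> K k \<and>
       0 < t \<and> t < \<bar>a - 1\<bar> \<and> t < \<bar>(1 - a) / a\<bar>"
    by eventually_elim auto
  then obtain t where t: "x + (a + t * a) *\<^sub>R v \<in> K k" "x + (1 + t) *\<^sub>R v \<in> K k"
     "0 < t" "t < \<bar>a - 1\<bar>" "t < \<bar>(1 - a) / a\<bar>"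
    using eventually_happens' trivial_limit_at_right_real by fastforce
  have no: "\<not> (x + s *\<^sub>R v \<in> K k \<and> x + u *\<^sub>R v \<in> K k)"
    if "s \<le> m" "m \<le> u" "m = a \<or> m = 1" for s u m
    using convex_line[OF bspec[OF K \<open>k \<in> {1..3}\<close>], of x s v u m] that pq by (auto simp: a v_def)
  consider "a < 0" | "0 < a" "a < 1" | "1 < a" using a01 by linarith
  then show False
  proof cases
    case 1
    then have "t * a < 0" using t by (simp add: mult_pos_neg)
    then show False using no[of "a + t * a" a "1 + t"] t 1 by auto
  next
    case 2
    then have "a + t * a \<le> 1" using t(5) by (simp add: field_simps)
    then show False using no[of "a + t * a" 1 "1 + t"] t by auto
  next
    case 3
    then have "t * a > 0" using t by simp
    then show False using no[of "1 + t" a "a + t * a"] t 3 by auto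
  qed
qed

section \<open>Supporting half-spaces and the flat they determine\<close>

text \<open>The normal is taken in the direction space of \<open>A\<close>, so that its hyperplane
  through \<open>p\<close> cuts \<open>A\<close> properly. A set that misses \<open>A\<close> also
  gets a normal, any nonzero direction of \<open>A\<close>, and all three sets are treated
  alike.\<close>

lemma supporting_normal:
  fixes A :: "'a::euclidean_space set"
  assumes A: "affine A" and p: "p \<in> A" "A \<noteq> {p}" and C: "convex C" "p \<notin> C"
  obtains a where "a \<noteq> 0" "p + a \<in> A" "\<And>x. x \<in> C \<inter> A \<Longrightarrow> 0 \<le> a \<bullet> (x - p)"
proof (cases "C \<inter> A = {}")
  case True
  obtain q where "q \<in> A" "q \<noteq> p" using p by blast
  then show ?thesis using True that[of "q - p"] by auto
next
  case False
  define T where "T = (\<lambda>x. x - p) ` A"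
  have T: "subspace T"
    using affine_diffs_subspace_subtract[OF A p(1)] by (simp add: T_def)
  define D where "D = (\<lambda>x. x - p) ` (C \<inter> A)"
  have "convex D" unfolding D_def
    by (intro convex_translation_subtract convex_Int affine_imp_convex C A)
  moreover have "D \<noteq> {}" "0 \<notin> D" using False C by (auto simp: D_def)
  ultimately obtain a where a: "a \<in> span D" "a \<noteq> 0" "\<forall>x\<in>D. 0 \<le> a \<bullet> x"
    using separating_hyperplane_set_0_inspan[of D] by metis
  have "span D \<subseteq> T" using T by (intro span_minimal) (auto simp: D_def T_def)
  then have "p + a \<in> A" using a(1) by (auto simp: T_def)
  then show ?thesis using that a by (auto simp: D_def)
qed

text \<open>If the supporting normals at \<open>p\<close> had a common strictly positive direction \<open>b\<close>, then
  \<open>p - t b\<close> would be uncovered for small \<open>t > 0\<close>. Hence \<open>0\<close> is a convex combination of them, and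
  off the common kernel of the normals with positive weight some half-space is left.\<close>

lemma supporting_flat:
  fixes A :: "'a::euclidean_space set"
  assumes A: "affine A" and K: "\<forall>i\<in>{1..3}. convex (K i)"
    and p: "p \<in> encapsulated_points A 3 K" and Ap: "A \<noteq> {p}"
  obtains W where "affine W" "p \<in> W" "W \<subset> A"
    "encapsulated_points A 3 K - (\<Union>i\<in>{1..3}. unadjacent_points A K i) \<subseteq> W"
proof -
  have pA: "p \<in> A" using p encapsulated_pointsD by blast
  have "\<forall>i\<in>{1..3}. \<exists>a. a \<noteq> 0 \<and> p + a \<in> A \<and> (\<forall>x\<in>K i \<inter> A. 0 \<le> a \<bullet> (x - p))"
    using supporting_normal[OF A pA Ap bspec[OF K] encapsulated_pointsD(2)[OF p]] by metis
  then obtain a where a: "\<And>i. i \<in> {1..3} \<Longrightarrow> a i \<noteq> 0" "\<And>i. i \<in> {1..3} \<Longrightarrow> p + a i \<in> A"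
    "\<And>i x. i \<in> {1..3} \<Longrightarrow> x \<in> K i \<inter> A \<Longrightarrow> 0 \<le> a i \<bullet> (x - p)"
    by metis
  define B where "B = a ` {1..3::nat}"
  have B: "finite B" "B \<noteq> {}" by (auto simp: B_def)
  have "0 \<in> convex hull B"
  proof (rule ccontr)
    assume "0 \<notin> convex hull B"
    \<comment> \<open>The vector \<open>b\<close> is chosen in the hull of the normals, hence in the
      direction space of \<open>A\<close>: the ray from \<open>p\<close> along \<open>- b\<close>
      stays in \<open>A\<close>.\<close>
    then obtain b c where b: "b \<in> convex hull B" "b \<noteq> 0" "c > 0" "\<forall>x\<in>convex hull B. b \<bullet> x > c"
      using separating_hyperplane_closed_0_inset[of "convex hull B"] B
      by (metis convex_convex_hull convex_hull_eq_empty finite_imp_compact_convex_hull compact_imp_closed)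
    have "subspace ((\<lambda>x. x - p) ` A)"
      using affine_diffs_subspace_subtract[OF A pA] .
    then have "convex ((\<lambda>x. x - p) ` A)" by (rule subspace_imp_convex)
    moreover have "B \<subseteq> (\<lambda>x. x - p) ` A" using a(2) by (force simp: B_def)
    ultimately have "convex hull B \<subseteq> (\<lambda>x. x - p) ` A" by (simp add: hull_minimal)
    then have pb: "p + b \<in> A" using b(1) by auto
    have mem: "p + t *\<^sub>R (- b) \<in> A" for t
      using affine_diff_mem[OF A pA pA pb, of t] by simp
    have "\<forall>\<^sub>F t in at_right 0. \<exists>i\<in>{1..3}. p + t *\<^sub>R (- b) \<in> K i"
      using encapsulated_direction[OF p _ mem] b(2) by simp
    then obtain t i where t: "0 < t" "i \<in> {1..3}" "p + t *\<^sub>R (- b) \<in> K i"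
      using eventually_at_right_0_ex by blast
    have "0 \<le> a i \<bullet> (t *\<^sub>R (- b))" using a(3)[OF t(2), of "p + t *\<^sub>R (- b)"] t(3) mem by simp
    moreover have "a i \<in> convex hull B" using t(2) by (intro hull_inc) (simp add: B_def)
    then have "b \<bullet> a i > 0" using b by force
    then have "a i \<bullet> (t *\<^sub>R (- b)) < 0" using t(1) by (simp add: inner_commute)
    ultimately show False by simp
  qed
  then obtain u where u: "\<forall>x\<in>B. 0 \<le> u x" "sum u B = 1" "(\<Sum>x\<in>B. u x *\<^sub>R x) = 0"
    unfolding convex_hull_finite[OF B(1)] by auto
  define W where "W = A \<inter> (\<Inter>x\<in>{x\<in>B. 0 < u x}. {y. x \<bullet> y = x \<bullet> p})"
  have "affine W" unfolding W_def
    by (intro affine_Int A affine_Inter) (auto simp: affine_hyperplane)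
  moreover have "p \<in> W" using pA by (simp add: W_def)
  moreover have "W \<subset> A"
  proof -
    have "\<exists>x\<in>B. 0 < u x"
    proof (rule ccontr)
      assume "\<not> (\<exists>x\<in>B. 0 < u x)"
      then have "sum u B = 0" using u(1) by (intro sum.neutral) force
      then show False using u(2) by simp
    qed
    then obtain x where x: "x \<in> B" "0 < u x" by blast
    then have "x \<noteq> 0" "p + x \<in> A" using a by (auto simp: B_def)
    moreover have "p + x \<notin> W" using x \<open>x \<noteq> 0\<close> by (auto simp: W_def inner_add_right)
    ultimately show ?thesis by (auto simp: W_def)
  qed
  moreover have "encapsulated_points A 3 K - (\<Union>i\<in>{1..3}. unadjacent_points A K i) \<subseteq> W"
  proof
    fix q assume q: "q \<in> encapsulated_points A 3 K - (\<Union>i\<in>{1..3}. unadjacent_points A K i)"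
    then have qA: "q \<in> A" using encapsulated_pointsD by blast
    \<comment> \<open>Here the removal of unadjacent points enters: \<open>q\<close> is in the
      closure of every \<open>K i \<inter> A\<close>, so it satisfies all three half-space
      inequalities. Their weighted sum is zero, which forces equality wherever the weight is
      positive.\<close>
    have nonneg: "0 \<le> x \<bullet> (q - p)" if x: "x \<in> B" for x
    proof -
      obtain i where i: "i \<in> {1..3}" "x = a i" using x by (auto simp: B_def)
      have "closure (K i \<inter> A) \<subseteq> {y. a i \<bullet> y \<ge> a i \<bullet> p}"
        using a(3)[OF i(1)] by (intro closure_minimal closed_halfspace_ge) (force simp: inner_diff_right)
      moreover have "q \<in> closure (K i \<inter> A)" using q i(1) by (auto simp: unadjacent_points_def)
      ultimately show ?thesis using i by (auto simp: inner_diff_right)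
    qed
    have "(\<Sum>x\<in>B. u x * (x \<bullet> (q - p))) = (\<Sum>x\<in>B. u x *\<^sub>R x) \<bullet> (q - p)"
      by (simp add: inner_sum_left)
    then have "(\<Sum>x\<in>B. u x * (x \<bullet> (q - p))) = 0" using u(3) by simp
    then have "\<forall>x\<in>B. u x * (x \<bullet> (q - p)) = 0"
      using u(1) nonneg B(1) by (subst (asm) sum_nonneg_eq_0_iff) auto
    then show "q \<in> W" using qA by (auto simp: W_def inner_diff_right)
  qed
  ultimately show ?thesis using that by blast
qed

section \<open>Counting by induction on the dimension\<close>

lemma not_disjoint_obtain:
  assumes "\<not> disjoint_family_on (\<lambda>i. K i \<inter> A) {1..3::nat}"
  obtains i j k x where "{i, j, k} = {1..3}" "k \<noteq> i" "k \<noteq> j" "x \<in> A" "x \<in> K i" "x \<in> K j"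
proof -
  obtain i j x where x: "i \<in> {1..3}" "j \<in> {1..3}" "i \<noteq> j" "x \<in> A" "x \<in> K i" "x \<in> K j"
    using assms unfolding disjoint_family_on_def by blast
  have ij: "i \<in> {1, 2, 3}" "j \<in> {1, 2, 3}" using x(1,2) unfolding atLeastAtMost_1_3 .
  \<comment> \<open>Since 1 + 2 + 3 = 6, this is the remaining index.\<close>
  then have "{i, j, 6 - (i + j)} = {1..3}" "6 - (i + j) \<noteq> i" "6 - (i + j) \<noteq> j"
    using x(3) unfolding atLeastAtMost_1_3 by auto
  then show ?thesis using that x(4-6) by metis
qed

lemma card_unadjacent_points_common:
  assumes A: "affine A" and K: "\<forall>i\<in>{1..3}. convex (K i)"
    and nd: "\<not> disjoint_family_on (\<lambda>i. K i \<inter> A) {1..3::nat}"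
  shows "card (\<Union>i\<in>{1..3}. unadjacent_points A K i) < 3"
proof -
  obtain i j k x where x: "{i, j, k} = {1..3}" "k \<noteq> i" "k \<noteq> j" "x \<in> A" "x \<in> K i" "x \<in> K j"
    using not_disjoint_obtain[OF nd] by blast
  have "unadjacent_points A K k = {}"
    using common_point_unadjacent[OF A K x(1) x(4-6)] .
  then have "(\<Union>i\<in>{1..3}. unadjacent_points A K i) = (\<Union>i\<in>{1..3}-{k}. unadjacent_points A K i)"
    by blast
  also have "card \<dots> \<le> card ({1..3} - {k})"
    using card_unadjacent_points(2)[OF A K] by blast
  also have "\<dots> < 3"
  proof -
    have "k \<in> {1..3}" unfolding x(1)[symmetric] by simp
    then show ?thesis by (simp add: card_Diff_singleton)
  qed
  finally show ?thesis .
qed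

lemma card_le_1_if:
  assumes "\<And>p q. p \<in> S \<Longrightarrow> q \<in> S \<Longrightarrow> p = q"
  shows "finite S" "card S \<le> 1"
proof -
  have "\<exists>p. S \<subseteq> {p}" using assms by blast
  then show "finite S" "card S \<le> 1" using finite_subset card_mono[of "{_}" S] by fastforce+
qed

text \<open>Of three collinear points one lies between the other two, which
  \<open>no_three_between\<close> excludes. An infinite set would contain three points, so
  finiteness follows too.\<close>

lemma encapsulated_points_collinear:
  fixes A :: "'a::euclidean_space set"
  assumes A: "affine A" and K: "\<forall>i\<in>{1..3}. convex (K i)" and col: "collinear A"
  shows "finite (encapsulated_points A 3 K)" "card (encapsulated_points A 3 K) \<le> 2"
    "\<not> disjoint_family_on (\<lambda>i. K i \<inter> A) {1..3::nat} \<Longrightarrow> card (encapsulated_points A 3 K) \<le> 1"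
proof -
  let ?S = "encapsulated_points A 3 K"
  have no3: "\<not> (T \<subseteq> ?S \<and> card T = 3)" for T
  proof
    assume T: "T \<subseteq> ?S \<and> card T = 3"
    then obtain p q r where pqr: "T = {p, q, r}" "p \<noteq> q" "q \<noteq> r" "p \<noteq> r"
      by (auto simp: card_3_iff)
    then have S: "p \<in> ?S" "q \<in> ?S" "r \<in> ?S" using T by auto
    then have "{p, q, r} \<subseteq> A" using encapsulated_pointsD(1) by blast
    then have "collinear {p, q, r}" using col collinear_subset by metis
    then consider "between (q, r) p" | "between (r, p) q" | "between (p, q) r"
      unfolding collinear_between_cases by blast
    then show False
      using no_three_between[OF A K S(2,1,3)] no_three_between[OF A K S(3,2,1)]
        no_three_between[OF A K S(1,3,2)] pqr(2-4) by cases auto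
  qed
  show fin: "finite ?S" using no3 infinite_arbitrarily_large[of ?S 3] by blast
  show "card ?S \<le> 2"
  proof (rule ccontr)
    assume "\<not> card ?S \<le> 2"
    then obtain T where "T \<subseteq> ?S" "card T = 3" using obtain_subset_with_card_n[of 3 ?S] by auto
    then show False using no3 by blast
  qed
  show "card ?S \<le> 1" if nd: "\<not> disjoint_family_on (\<lambda>i. K i \<inter> A) {1..3::nat}"
  proof -
    obtain i j k x where x: "{i, j, k} = {1..3}" "k \<noteq> i" "k \<noteq> j" "x \<in> A" "x \<in> K i" "x \<in> K j"
      using nd by (rule not_disjoint_obtain)
    show ?thesis
      by (rule card_le_1_if(2)) (rule common_point_collinear[OF A K x(1) x(4-6) col])
  qed
qed

text \<open>The recursion in steps of two is the shape of both inductions: two more dimensions allow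
  exactly three more points.\<close>

lemma max_encapsulated_simps [simp]:
  "max_encapsulated 0 = 1" "max_encapsulated (Suc 0) = 2"
  "max_encapsulated (Suc (Suc d)) = max_encapsulated d + 3"
  by (simp_all add: max_encapsulated_def)

lemma max_encapsulated_less_Suc: "max_encapsulated d < max_encapsulated (Suc d)"
  by (simp add: max_encapsulated_def)

text \<open>Parts (a) and (b) are proved together, (b) as a strict bound when two traces overlap.
  The dimension is only bounded above, so the induction hypothesis applies to any intersection of
  flats, even an empty one.\<close>

lemma encapsulated_points_bound:
  fixes A :: "'a::euclidean_space set"
  assumes K: "\<forall>i\<in>{1..3}. convex (K i)" and "affine A" "aff_dim A \<le> int d"
  shows "finite (encapsulated_points A 3 K) \<and> card (encapsulated_points A 3 K) \<le> max_encapsulated d \<and>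
    (\<not> disjoint_family_on (\<lambda>i. K i \<inter> A) {1..3::nat} \<longrightarrow> card (encapsulated_points A 3 K) < max_encapsulated d)"
  using assms(2,3)
proof (induction d arbitrary: A rule: less_induct)
  case (less d)
  let ?S = "\<lambda>A. encapsulated_points A 3 K"
  note A = less.prems(1)
  consider "d = 0" | "d = 1" | e where "d = Suc (Suc e)"
    by (metis One_nat_def not0_implies_Suc)
  then show ?case
  proof cases
    case 1
    then have "aff_dim A = -1 \<or> aff_dim A = 0" using less.prems(2) aff_dim_geq[of A] by linarith
    then have eq: "\<exists>a. A \<subseteq> {a}" using aff_dim_empty aff_dim_eq_0 by (metis empty_subsetI order_refl)
    have S: "finite (?S A)" "card (?S A) \<le> 1"
      by (rule card_le_1_if; use eq encapsulated_pointsD(1) in blast)+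
    have "?S A = {}" if nd: "\<not> disjoint_family_on (\<lambda>i. K i \<inter> A) {1..3::nat}"
    proof -
      obtain i x where "i \<in> {1..3}" "x \<in> A" "x \<in> K i"
        using not_disjoint_obtain[OF nd] by (metis insertI1)
      then show ?thesis using eq encapsulated_pointsD by blast
    qed
    then show ?thesis using S 1 by auto
  next
    case 2
    then have "collinear A" using less.prems(2) by (simp add: collinear_aff_dim)
    then show ?thesis using encapsulated_points_collinear[OF A K] 2 by fastforce
  next
    case (3 e)
    let ?E = "\<Union>i\<in>{1..3}. unadjacent_points A K i"
    have E: "finite ?E" "card ?E \<le> 3"
      using card_unadjacent_points[OF A K] card_unadjacent_points(2)[OF A K, of "{1..3}"] by auto
    \<comment> \<open>If all encapsulated points lie in a flat of dimension below \<open>d\<close>,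
      the strict growth of \<open>max_encapsulated\<close> makes the bound strict, whether or not
      the sets overlap.\<close>
    have low: ?thesis if F: "affine F" "aff_dim F \<le> int (Suc e)" "?S A \<subseteq> F" "F \<subseteq> A" for F
    proof -
      have IH: "finite (?S F)" "card (?S F) \<le> max_encapsulated (Suc e)"
        using less.IH[OF _ F(1,2)] 3 by auto
      have sub: "?S A \<subseteq> ?S F" using encapsulated_points_Int[OF F(4), of 3 K] F(3) by blast
      then have "card (?S A) \<le> card (?S F)" using IH(1) by (rule card_mono[rotated])
      then show ?thesis
        using sub IH max_encapsulated_less_Suc[of "Suc e"] finite_subset 3 by fastforce
    qed
    show ?thesis
    proof (cases "aff_dim A \<le> int (Suc e) \<or> ?S A = {}")
      case True
      then show ?thesis
        using low[of A] low[of "{}"] A encapsulated_pointsD(1) by (auto simp: subset_iff)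
    next
      case False
      then obtain p where p: "p \<in> ?S A" by blast
      have sing: "A \<noteq> {x}" for x using False by auto
      obtain W where W: "affine W" "p \<in> W" "W \<subset> A" "?S A - ?E \<subseteq> W"
        using supporting_flat[OF A K p sing] by blast
      have dim: "aff_dim X < aff_dim Y" if "affine X" "affine Y" "X \<subset> Y" for X Y :: "'a set"
        using that aff_dim_psubset[of X Y] by (metis affine_hull_eq)
      show ?thesis
      proof (cases "?S A \<subseteq> W")
        case True
        then show ?thesis using low[OF W(1)] W(3) dim[OF W(1) A W(3)] less.prems(2) 3 by auto
      next
        case False
        then obtain q where q: "q \<in> ?S A" "q \<notin> W" by blast
        obtain W' where W': "affine W'" "q \<in> W'" "W' \<subset> A" "?S A - ?E \<subseteq> W'"
          using supporting_flat[OF A K q(1) sing] by blast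
        \<comment> \<open>As \<open>q\<close> is in \<open>W'\<close> but not in \<open>W\<close>,
          the flat \<open>F\<close> is proper in \<open>W'\<close>, which is proper in
          \<open>A\<close>: the dimension drops twice. Both \<open>W\<close> and \<open>W'\<close>
          contain all encapsulated points outside \<open>?E\<close>, hence so does
          \<open>F\<close>.\<close>
        define F where "F = W \<inter> W'"
        have F: "affine F" "F \<subset> W'" "F \<subseteq> A" "?S A - ?E \<subseteq> F"
          using W W' q by (auto simp: F_def affine_Int)
        have "aff_dim F \<le> int e"
          using dim[OF F(1) W'(1) F(2)] dim[OF W'(1) A W'(3)] less.prems(2) 3 by simp
        then have IH: "finite (?S F)" "card (?S F) \<le> max_encapsulated e"
          using less.IH[of e, OF _ F(1)] 3 by auto
        have sub: "?S A \<subseteq> ?E \<union> ?S F"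
          using encapsulated_points_Int[OF F(3), of 3 K] F(4) by blast
        then have fin: "finite (?S A)" using E(1) IH(1) finite_subset by blast
        have "card (?S A) \<le> card (?E \<union> ?S F)" using sub E(1) IH(1) by (intro card_mono) auto
        also have "\<dots> \<le> card ?E + card (?S F)" by (rule card_Un_le)
        finally have "card (?S A) \<le> card ?E + max_encapsulated e" using IH(2) by simp
        then show ?thesis
          using fin E(2) card_unadjacent_points_common[OF A K] 3 by fastforce
      qed
    qed
  qed
qed

section \<open>Construction of the extremal sets\<close>

lemma distinct_pair_1_3_cases:
  assumes "i \<in> {1..3}" "j \<in> {1..3}" "i \<noteq> (j::nat)"
  obtains "i = 1" "j = 2" | "i = 1" "j = 3" | "i = 2" "j = 1" | "i = 2" "j = 3" | "i = 3" "j = 1" | "i = 3" "j = 2"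
proof -
  have "i \<in> {1, 2, 3}" "j \<in> {1, 2, 3}" using assms unfolding atLeastAtMost_1_3 by blast+
  then show ?thesis using that assms(3) by blast
qed

text \<open>Antisymmetric for distinct indices: one formula describes both strict sides of a cut,
  the order of the indices choosing the side.\<close>

definition cut_sign :: "nat \<Rightarrow> nat \<Rightarrow> real"
  where "cut_sign i j = (if i < j then 1 else -1)"

text \<open>Equivalently, \<open>z\<close> is not in \<open>D\<close>, and both \<open>D\<close> and
  \<open>insert z D\<close> are convex. The second condition is needed when the fibre over
  \<open>z\<close> is divided between the two sides of a refined cut.\<close>

definition punctured_convex :: "'a::real_vector set \<Rightarrow> 'a \<Rightarrow> bool"
  where "punctured_convex D z \<longleftrightarrow> z \<notin> D \<and>
    (\<forall>x\<in>D. \<forall>y\<in>insert z D. \<forall>u. 0 < u \<longrightarrow> u < 1 \<longrightarrow> (1 - u) *\<^sub>R x + u *\<^sub>R y \<in> D)"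

lemma punctured_convexD:
  assumes "punctured_convex D z"
  shows "z \<notin> D"
    and "x \<in> D \<Longrightarrow> y \<in> D \<or> y = z \<Longrightarrow> 0 < u \<Longrightarrow> u < 1 \<Longrightarrow> (1 - u) *\<^sub>R x + u *\<^sub>R y \<in> D"
    and "y \<in> D \<Longrightarrow> x \<in> D \<or> x = z \<Longrightarrow> 0 < u \<Longrightarrow> u < 1 \<Longrightarrow> (1 - u) *\<^sub>R x + u *\<^sub>R y \<in> D"
proof -
  show "z \<notin> D" using assms by (simp add: punctured_convex_def)
  show *: "(1 - u) *\<^sub>R x + u *\<^sub>R y \<in> D"
    if "x \<in> D" "y \<in> D \<or> y = z" "0 < u" "u < 1" for x y u
    using assms that unfolding punctured_convex_def by blast
  show "(1 - u) *\<^sub>R x + u *\<^sub>R y \<in> D" if "y \<in> D" "x \<in> D \<or> x = z" "0 < u" "u < 1"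
    using *[of y x "1 - u"] that by (simp add: add.commute)
qed

text \<open>The convex sets \<open>K i\<close> are carried through the induction together with cuts:
  \<open>D i j\<close> and \<open>D j i\<close> cover \<open>V - {z i j}\<close> and separate \<open>K i\<close> from \<open>K j\<close>.\<close>

definition cut_system ::
    "'a::real_vector set \<Rightarrow> (nat \<Rightarrow> 'a set) \<Rightarrow> (nat \<Rightarrow> nat \<Rightarrow> 'a set) \<Rightarrow> (nat \<Rightarrow> nat \<Rightarrow> 'a) \<Rightarrow> bool"
  where "cut_system V K D z \<longleftrightarrow>
    (\<forall>i\<in>{1..3}. convex (K i) \<and> K i \<subseteq> V) \<and>
    (\<forall>i\<in>{1..3}. \<forall>j\<in>{1..3}-{i}. K i \<subseteq> D i j \<and> D i j \<subseteq> V \<and> punctured_convex (D i j) (z i j) \<and>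
       z i j \<in> V \<and> z i j = z j i \<and> V - {z i j} \<subseteq> D i j \<union> D j i)"

lemma cut_systemD:
  assumes "cut_system V K D z"
  shows "i \<in> {1..3} \<Longrightarrow> convex (K i)" "i \<in> {1..3} \<Longrightarrow> K i \<subseteq> V"
    and "i \<in> {1..3} \<Longrightarrow> j \<in> {1..3} \<Longrightarrow> i \<noteq> j \<Longrightarrow> K i \<subseteq> D i j"
    and "i \<in> {1..3} \<Longrightarrow> j \<in> {1..3} \<Longrightarrow> i \<noteq> j \<Longrightarrow> D i j \<subseteq> V"
    and "i \<in> {1..3} \<Longrightarrow> j \<in> {1..3} \<Longrightarrow> i \<noteq> j \<Longrightarrow> punctured_convex (D i j) (z i j)"
    and "i \<in> {1..3} \<Longrightarrow> j \<in> {1..3} \<Longrightarrow> i \<noteq> j \<Longrightarrow> z i j \<in> V"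
    and "i \<in> {1..3} \<Longrightarrow> j \<in> {1..3} \<Longrightarrow> i \<noteq> j \<Longrightarrow> z i j = z j i"
    and "i \<in> {1..3} \<Longrightarrow> j \<in> {1..3} \<Longrightarrow> i \<noteq> j \<Longrightarrow> V - {z i j} \<subseteq> D i j \<union> D j i"
  using assms unfolding cut_system_def by blast+

definition hole_set :: "'a set \<Rightarrow> (nat \<Rightarrow> 'a set) \<Rightarrow> 'a set"
  where "hole_set V K = V - (\<Union>i\<in>{1..3}. K i)"

text \<open>The points of a finite set are isolated, so in the construction it suffices to count
  uncovered points.\<close>

lemma encapsulated_points_eq_complement:
  fixes V :: "'a::euclidean_space set"
  assumes "finite (V - (\<Union>i\<in>{1..n}. K i))"
  shows "encapsulated_points V n K = V - (\<Union>i\<in>{1..n}. K i)"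
proof
  let ?T = "V - (\<Union>i\<in>{1..n}. K i)"
  show "encapsulated_points V n K \<subseteq> ?T"
    unfolding encapsulated_points_def encapsulated_def by blast
  show "?T \<subseteq> encapsulated_points V n K"
  proof
    fix p assume p: "p \<in> ?T"
    have "\<exists>e>0. \<forall>x\<in>?T. x \<noteq> p \<longrightarrow> e \<le> dist p x"
      using finite_set_avoid[OF assms] .
    then obtain e where e: "e > 0" "\<forall>x\<in>?T. x \<noteq> p \<longrightarrow> e \<le> dist p x" by blast
    then have "ball p e \<inter> V - (\<Union>i\<in>{1..n}. K i) = {p}"
      using p by force
    then show "p \<in> encapsulated_points V n K"
      using e(1) p unfolding encapsulated_points_def encapsulated_def by blast
  qed
qed

section \<open>Dimensions 0 and 1\<close>

lemma cut_system_0: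
  "cut_system {0} (\<lambda>_. {}) (\<lambda>_ _. {}) (\<lambda>_ _. 0)"
  by (auto simp: cut_system_def punctured_convex_def)

lemma cut_system_1:
  fixes e :: "'a::euclidean_space"
  assumes e: "norm e = 1"
  obtains K D z where "cut_system (span {e}) K D z" "hole_set (span {e}) K = {0, e}"
proof -
  \<comment> \<open>In the coordinate along \<open>e\<close> the sets are x < 0, 0 < x < 1 and x >
    1. The cut at 0 separates the first set from the others, the cut at 1 the second from the
    third.\<close>
  define c where "c i j = (if i = 1 \<or> j = 1 then 0 else 1 :: real)" for i j :: nat
  define D where "D i j = {x \<in> span {e}. cut_sign i j * (e \<bullet> x - c i j) < 0}" for i j
  define K where "K i = (\<Inter>j\<in>{1..3}-{i}. D i j)" for i
  define z where "z i j = c i j *\<^sub>R e" for i j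
  have ee: "e \<bullet> e = 1" using e by (simp add: dot_square_norm)
  have span_eq: "x = (e \<bullet> x) *\<^sub>R e" if "x \<in> span {e}" for x
    using that ee by (auto simp: span_singleton)
  have pc: "punctured_convex (D i j) (z i j)" for i j
    unfolding punctured_convex_def
  proof (intro conjI ballI allI impI)
    show "z i j \<notin> D i j" by (simp add: D_def z_def ee)
    fix x y and u :: real
    assume x: "x \<in> D i j" and y: "y \<in> insert (z i j) (D i j)" and u: "0 < u" "u < 1"
    have "y \<in> span {e}" using y by (auto simp: D_def z_def span_base span_scale)
    then have "(1 - u) *\<^sub>R x + u *\<^sub>R y \<in> span {e}"
      using x by (intro span_add span_scale) (auto simp: D_def)
    moreover have "cut_sign i j * (e \<bullet> y - c i j) \<le> 0" using y by (auto simp: D_def z_def ee)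
    then have "(1 - u) * (cut_sign i j * (e \<bullet> x - c i j)) + u * (cut_sign i j * (e \<bullet> y - c i j)) < 0"
      using x u by (intro add_neg_nonpos) (auto simp: D_def mult_pos_neg mult_nonneg_nonpos)
    then have "cut_sign i j * (e \<bullet> ((1 - u) *\<^sub>R x + u *\<^sub>R y) - c i j) < 0"
      by (simp add: inner_add_right algebra_simps)
    ultimately show "(1 - u) *\<^sub>R x + u *\<^sub>R y \<in> D i j" by (simp add: D_def)
  qed
  have conv: "convex (D i j)" for i j
  proof (cases "i < j")
    case True
    then have "D i j = span {e} \<inter> {x. e \<bullet> x < c i j}" by (auto simp: D_def cut_sign_def)
    then show ?thesis by (simp add: convex_Int convex_halfspace_lt subspace_imp_convex)
  next
    case False
    then have "D i j = span {e} \<inter> {x. e \<bullet> x > c i j}" by (auto simp: D_def cut_sign_def)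
    then show ?thesis by (simp add: convex_Int convex_halfspace_gt subspace_imp_convex)
  qed
  have cov: "span {e} - {z i j} \<subseteq> D i j \<union> D j i" if "i \<noteq> j" for i j
  proof
    fix x assume x: "x \<in> span {e} - {z i j}"
    then have "e \<bullet> x \<noteq> c i j" using span_eq[of x] by (auto simp: z_def)
    moreover have "c i j = c j i" by (simp add: c_def)
    ultimately show "x \<in> D i j \<union> D j i" using x that by (auto simp: D_def cut_sign_def)
  qed
  have Ksub: "K i \<subseteq> span {e}" if "i \<in> {1..3}" for i
    using that by (fastforce simp: K_def D_def atLeastAtMost_1_3)
  have "cut_system (span {e}) K D z"
    unfolding cut_system_def
    using pc conv cov Ksub
    by (auto simp: K_def z_def c_def span_base span_scale intro!: convex_INT) (auto simp: D_def)
  moreover have "hole_set (span {e}) K = {0, e}"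
  proof
    show "hole_set (span {e}) K \<subseteq> {0, e}"
    proof
      fix x assume x: "x \<in> hole_set (span {e}) K"
      then have xs: "x \<in> span {e}" by (simp add: hole_set_def)
      then have "e \<bullet> x = 0 \<or> e \<bullet> x = 1"
        using x by (auto simp: hole_set_def K_def D_def atLeastAtMost_1_3 cut_sign_def c_def)
      then show "x \<in> {0, e}" using span_eq[OF xs] by auto
    qed
    show "{0, e} \<subseteq> hole_set (span {e}) K"
      by (auto simp: hole_set_def K_def D_def atLeastAtMost_1_3 insert_Diff_if cut_sign_def c_def span_base span_zero ee)
  qed
  ultimately show ?thesis using that by blast
qed

section \<open>Raising the dimension by two\<close>

locale cut_system_step =
  fixes V W :: "'a::euclidean_space set" and e1 e2 :: 'a and K D z
  assumes V: "subspace V" and e: "norm e1 = 1" "norm e2 = 1" "e1 \<bullet> e2 = 0" "e1 \<in> V" "e2 \<in> V"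
    and W: "W = {x\<in>V. e1 \<bullet> x = 0 \<and> e2 \<bullet> x = 0}"
    and sys: "cut_system W K D z"
begin

definition proj :: "'a \<Rightarrow> 'a" where "proj x = x - (e1 \<bullet> x) *\<^sub>R e1 - (e2 \<bullet> x) *\<^sub>R e2"
text \<open>The three linear forms x, y and 0 of a tropical line; sector \<open>i\<close> is where
  the form \<open>coord i\<close> is largest.\<close>

definition coord :: "nat \<Rightarrow> 'a \<Rightarrow> real"
  where "coord i x = (if i = 1 then e1 \<bullet> x else if i = 2 then e2 \<bullet> x else 0)"
text \<open>For \<open>i \<noteq> j\<close> in \<open>{1..3}\<close>, the third index is \<open>6 - (i + j)\<close>.\<close>

definition height :: "nat \<Rightarrow> nat \<Rightarrow> 'a \<Rightarrow> real"
  where "height i j x = coord i x - coord (6 - (i + j)) x"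
text \<open>The direction in which the two forms other than \<open>k\<close> stay equal and exceed
  \<open>coord k\<close>, scaled so that \<open>height\<close> is 1 at its tip.\<close>

definition ray :: "nat \<Rightarrow> 'a"
  where "ray k = (if k = 1 then - e1 else if k = 2 then - e2 else e1 + e2)"
text \<open>Lexicographic refinement: the coordinates decide first, on a tie the old cut of the
  projection, and over its missing point \<open>z i j\<close> the height relative to 1. Only
  \<open>z' i j\<close> remains undecided.\<close>

definition D' :: "nat \<Rightarrow> nat \<Rightarrow> 'a set"
  where "D' i j = {x\<in>V. coord i x > coord j x \<or> coord i x = coord j x \<and>
    (proj x \<in> D i j \<or> proj x = z i j \<and> cut_sign i j * (height i j x - 1) < 0)}"
text \<open>On \<open>W\<close> all three forms agree and the refined cuts alone could fill old
  holes, for instance the origin when \<open>W\<close> is \<open>{0}\<close>. The extra condition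
  makes the trace of \<open>K' i\<close> on \<open>W\<close> equal to \<open>K i\<close>.\<close>

definition K' :: "nat \<Rightarrow> 'a set"
  where "K' i = {x \<in> \<Inter>j\<in>{1..3}-{i}. D' i j. (\<forall>j\<in>{1..3}. coord j x = coord i x) \<longrightarrow> x \<in> K i}"
definition z' :: "nat \<Rightarrow> nat \<Rightarrow> 'a"
  where "z' i j = z i j + ray (6 - (i + j))"

lemma ee [simp]: "e1 \<bullet> e1 = 1" "e2 \<bullet> e2 = 1" "e1 \<bullet> e2 = 0" "e2 \<bullet> e1 = 0"
  using e by (auto simp: dot_square_norm inner_commute)

lemma zW:
  assumes "i \<in> {1..3}" "j \<in> {1..3}" "i \<noteq> j"
  shows "z i j \<in> V" "e1 \<bullet> z i j = 0" "e2 \<bullet> z i j = 0"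
  using cut_systemD(6)[OF sys assms] by (auto simp: W)

lemma linear_coord: "coord i (a *\<^sub>R x + b *\<^sub>R y) = a * coord i x + b * coord i y"
  by (simp add: coord_def inner_add_right)

lemma linear_proj: "proj (a *\<^sub>R x + b *\<^sub>R y) = a *\<^sub>R proj x + b *\<^sub>R proj y"
  by (simp add: proj_def inner_add_right algebra_simps)

lemma proj_W: "x \<in> V \<Longrightarrow> proj x \<in> W"
  using V e by (auto simp: W proj_def inner_diff_right intro!: subspace_diff subspace_scale)

lemma coord_W: "x \<in> W \<Longrightarrow> coord i x = 0"
  by (simp add: W coord_def)

lemma all_coord_eq: "x \<in> W \<longleftrightarrow> x \<in> V \<and> (\<forall>j\<in>{1..3}. coord j x = coord i x)" if "i \<in> {1..3}"
  using that by (auto simp: W coord_def atLeastAtMost_1_3)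

lemma proj_id: "x \<in> W \<Longrightarrow> proj x = x"
  by (simp add: proj_def W)

lemma z'_props:
  assumes "i \<in> {1..3}" "j \<in> {1..3}" "i \<noteq> j"
  shows "z' i j \<in> V" "proj (z' i j) = z i j" "coord i (z' i j) = coord j (z' i j)" "height i j (z' i j) = 1"
proof -
  note z = zW[OF assms]
  show "z' i j \<in> V"
    using z e V by (auto simp: z'_def ray_def subspace_add subspace_diff)
  show "proj (z' i j) = z i j"
    using z by (simp add: z'_def proj_def ray_def inner_add_right inner_diff_right)
  show "coord i (z' i j) = coord j (z' i j)" "height i j (z' i j) = 1"
    by (cases rule: distinct_pair_1_3_cases[OF assms];
      use z in \<open>simp add: height_def coord_def z'_def ray_def inner_add_right inner_diff_right\<close>)+
qed

text \<open>The tie and the height together determine both plane coordinates, hence the component of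
  \<open>x\<close> orthogonal to \<open>W\<close>.\<close>

lemma eq_z':
  assumes "i \<in> {1..3}" "j \<in> {1..3}" "i \<noteq> j"
    and x: "coord i x = coord j x" "proj x = z i j" "height i j x = 1"
  shows "x = z' i j"
proof -
  have "x = proj x + (e1 \<bullet> x) *\<^sub>R e1 + (e2 \<bullet> x) *\<^sub>R e2" by (simp add: proj_def)
  moreover have "(e1 \<bullet> x) *\<^sub>R e1 + (e2 \<bullet> x) *\<^sub>R e2 = ray (6 - (i + j))"
    by (cases rule: distinct_pair_1_3_cases[OF assms(1-3)];
      use x in \<open>simp add: coord_def height_def ray_def\<close>)
  ultimately show ?thesis using x by (simp add: z'_def add.assoc)
qed

lemma z'_notin:
  assumes "i \<in> {1..3}" "j \<in> {1..3}" "i \<noteq> j"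
  shows "z' i j \<notin> D' i j"
  using z'_props[OF assms] punctured_convexD(1)[OF cut_systemD(5)[OF sys assms]]
  by (simp add: D'_def)

lemma height_comb: "height i j ((1 - u) *\<^sub>R x + u *\<^sub>R y) - 1 =
   (1 - u) * (height i j x - 1) + u * (height i j y - 1)"
  unfolding height_def linear_coord by (simp add: algebra_simps)

text \<open>At the first level that is not a tie at both ends, strictness at one end carries over to
  \<open>m\<close>. On the middle level one end may project to \<open>z i j\<close>, and punctured
  convexity of \<open>D i j\<close> is exactly what is needed; on the last level the heights combine
  linearly.\<close>

lemma D'_punctured:
  assumes ij: "i \<in> {1..3}" "j \<in> {1..3}" "i \<noteq> j"
  shows "punctured_convex (D' i j) (z' i j)"
  unfolding punctured_convex_def
proof (intro conjI ballI allI impI)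
  show "z' i j \<notin> D' i j" by (rule z'_notin[OF ij])
  fix x y and u :: real
  assume x: "x \<in> D' i j" and y: "y \<in> insert (z' i j) (D' i j)" and u: "0 < u" "u < 1"
  define m where "m = (1 - u) *\<^sub>R x + u *\<^sub>R y"
  note pc = punctured_convexD[OF cut_systemD(5)[OF sys ij]]
  have yV: "x \<in> V" "y \<in> V" using x y z'_props(1)[OF ij] by (auto simp: D'_def)
  then have mV: "m \<in> V" using V by (auto simp: m_def intro!: subspace_add subspace_scale)
  have ge: "coord i x \<ge> coord j x" "coord i y \<ge> coord j y" using x y z'_props(3)[OF ij] by (auto simp: D'_def)
  have coord_m: "coord i m - coord j m = (1 - u) * (coord i x - coord j x) + u * (coord i y - coord j y)"
    unfolding m_def linear_coord by (simp add: algebra_simps)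
  have proj_m: "proj m = (1 - u) *\<^sub>R proj x + u *\<^sub>R proj y" by (simp add: m_def linear_proj)
  show "m \<in> D' i j"
  proof (cases "coord i x = coord j x \<and> coord i y = coord j y")
    case False
    then have "coord i m - coord j m > 0"
      unfolding coord_m using ge u by (smt (verit) mult_nonneg_nonneg mult_pos_pos)
    then show ?thesis using mV by (simp add: D'_def)
  next
    case True
    then have eq: "coord i m = coord j m" using coord_m by simp
    have px: "proj x \<in> D i j \<or> proj x = z i j \<and> cut_sign i j * (height i j x - 1) < 0"
      using x True by (auto simp: D'_def)
    have py: "proj y \<in> D i j \<or> proj y = z i j \<and> cut_sign i j * (height i j y - 1) \<le> 0"
      using y True z'_props[OF ij] by (auto simp: D'_def)
    consider "proj x \<in> D i j" | "proj y \<in> D i j"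
      | "proj x = z i j" "proj y = z i j" "cut_sign i j * (height i j x - 1) < 0"
        "cut_sign i j * (height i j y - 1) \<le> 0"
      using px py by blast
    then show ?thesis
    proof cases
      case 1
      then have "proj m \<in> D i j" unfolding proj_m using pc(2) py u by blast
      then show ?thesis using eq mV by (simp add: D'_def)
    next
      case 2
      then have "proj m \<in> D i j" unfolding proj_m using pc(3) px u by blast
      then show ?thesis using eq mV by (simp add: D'_def)
    next
      case 3
      have "proj m = z i j" unfolding proj_m using 3 by (simp add: algebra_simps)
      moreover have "(1 - u) * (cut_sign i j * (height i j x - 1)) + u * (cut_sign i j * (height i j y - 1)) < 0"
        using 3 u by (intro add_neg_nonpos) (auto simp: mult_pos_neg mult_nonneg_nonpos)
      then have "cut_sign i j * (height i j m - 1) < 0"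
        unfolding m_def height_comb by (simp add: algebra_simps)
      ultimately show ?thesis using eq mV by (simp add: D'_def)
    qed
  qed
qed

lemma D'_cover:
  assumes ij: "i \<in> {1..3}" "j \<in> {1..3}" "i \<noteq> j"
  shows "V - {z' i j} \<subseteq> D' i j \<union> D' j i"
proof
  fix x assume x: "x \<in> V - {z' i j}"
  show "x \<in> D' i j \<union> D' j i"
  proof (cases "coord i x = coord j x")
    case True
    have h: "height j i x = height i j x" using True by (simp add: height_def add.commute)
    have "proj x \<in> W" using proj_W x by blast
    then have "proj x = z i j \<or> proj x \<in> D i j \<union> D j i" using cut_systemD(8)[OF sys ij] by blast
    moreover have "height i j x \<noteq> 1" if "proj x = z i j" using eq_z'[OF ij True that] x by blast
    moreover have "z j i = z i j" using cut_systemD(7)[OF sys ij] by simp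
    ultimately show ?thesis using x True h ij(3) by (auto simp: D'_def cut_sign_def)
  qed (use x in \<open>auto simp: D'_def\<close>)
qed

lemma D'_subset: "D' i j \<subseteq> V"
  by (auto simp: D'_def)

lemma K_subset_K':
  assumes i: "i \<in> {1..3}"
  shows "K i \<subseteq> K' i"
proof
  fix x assume x: "x \<in> K i"
  then have xW: "x \<in> W" using cut_systemD(2)[OF sys i] by blast
  have "x \<in> D' i j" if "j \<in> {1..3} - {i}" for j
    using cut_systemD(3)[OF sys i, of j] that x xW by (auto simp: D'_def coord_W proj_id) (simp add: W)
  then show "x \<in> K' i" using x by (auto simp: K'_def)
qed

lemma D'_coord_le: "x \<in> D' i j \<Longrightarrow> coord j x \<le> coord i x"
  by (auto simp: D'_def)

lemma K'_coord_le: "x \<in> K' i \<Longrightarrow> j \<in> {1..3} \<Longrightarrow> coord j x \<le> coord i x"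
  by (cases "j = i") (auto simp: K'_def intro: D'_coord_le)

text \<open>The extra condition on \<open>W\<close> preserves convexity because
  \<open>coord i\<close> is maximal on \<open>K' i\<close>: an inner point of a segment has all
  forms equal only if both ends do, and then both ends lie in \<open>K i\<close>.\<close>

lemma convex_K':
  assumes i: "i \<in> {1..3}"
  shows "convex (K' i)"
proof (rule convexI)
  fix x y and v u :: real
  assume xy: "x \<in> K' i" "y \<in> K' i" and uv: "0 \<le> v" "0 \<le> u" "v + u = 1"
  have v: "v = 1 - u" using uv by simp
  show "v *\<^sub>R x + u *\<^sub>R y \<in> K' i"
  proof (cases "u = 0 \<or> u = 1")
    case True
    then show ?thesis using xy v by auto
  next
    case False
    then have u: "0 < u" "u < 1" using uv by auto
    define m where "m = (1 - u) *\<^sub>R x + u *\<^sub>R y"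
    have mD: "m \<in> D' i j" if j: "j \<in> {1..3} - {i}" for j
    proof -
      have "x \<in> D' i j" "y \<in> D' i j" using xy j by (auto simp: K'_def)
      then show ?thesis
        unfolding m_def using j i u by (intro punctured_convexD(2)[OF D'_punctured]) auto
    qed
    have ge: "coord i x \<ge> coord j x" "coord i y \<ge> coord j y" if "j \<in> {1..3}" for j
      using K'_coord_le xy that by blast+
    have "m \<in> K i" if eq: "\<forall>j\<in>{1..3}. coord j m = coord i m"
    proof -
      have "coord j x = coord i x \<and> coord j y = coord i y" if j: "j \<in> {1..3}" for j
      proof -
        have "coord i m - coord j m = 0" using eq j by simp
        then have "(1 - u) * (coord i x - coord j x) + u * (coord i y - coord j y) = 0"
          unfolding m_def linear_coord by (simp add: algebra_simps)
        then show ?thesis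
          using ge[OF j] u by (smt (verit) mult_nonneg_nonneg mult_pos_pos)
      qed
      then have "x \<in> K i" "y \<in> K i" using xy by (auto simp: K'_def)
      then show ?thesis unfolding m_def
        using cut_systemD(1)[OF sys i] u by (intro convexD) auto
    qed
    then show ?thesis using mD by (simp add: K'_def m_def v)
  qed
qed

lemma K'_subset: "K' i \<subseteq> V"
proof
  fix x assume "x \<in> K' i"
  then have "j \<in> {1..3} - {i} \<Longrightarrow> x \<in> D' i j" for j by (simp add: K'_def)
  from this[of 1] this[of 2] show "x \<in> V" using D'_subset by (cases "i = 1") auto
qed

lemma cut_system_step: "cut_system V K' D' z'"
  unfolding cut_system_def
proof (intro conjI ballI)
  fix i j :: nat assume i: "i \<in> {1..3}" and "j \<in> {1..3} - {i}"
  then have j: "j \<in> {1..3}" "i \<noteq> j" by auto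
  show "K' i \<subseteq> D' i j" using j by (auto simp: K'_def)
  show "z' i j = z' j i"
    using cut_systemD(7)[OF sys i j] by (simp add: z'_def add.commute)
  show "punctured_convex (D' i j) (z' i j)" by (rule D'_punctured[OF i j])
  show "z' i j \<in> V" by (rule z'_props(1)[OF i j])
  show "V - {z' i j} \<subseteq> D' i j \<union> D' j i" by (rule D'_cover[OF i j])
qed (use convex_K' K'_subset D'_subset in auto)

text \<open>Away from the new points, every pair of indices has a side of its cut containing
  \<open>x\<close>. Either some index wins both its comparisons and, off \<open>W\<close>, its set
  contains \<open>x\<close>, or the wins form a cycle.\<close>

lemma hole_set_step: "hole_set V K' = hole_set W K \<union> {z' 1 2, z' 1 3, z' 2 3}"
proof
  show "hole_set V K' \<subseteq> hole_set W K \<union> {z' 1 2, z' 1 3, z' 2 3}"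
  proof
    fix x assume x: "x \<in> hole_set V K'"
    then have xV: "x \<in> V" by (simp add: hole_set_def)
    have nK: "x \<notin> K' i" if "i \<in> {1..3}" for i
      using that x by (auto simp: hole_set_def)
    show "x \<in> hole_set W K \<union> {z' 1 2, z' 1 3, z' 2 3}"
    proof (cases "x \<in> W")
      case True
      then have "x \<notin> K i" if "i \<in> {1..3}" for i using nK[OF that] K_subset_K'[OF that] by blast
      then show ?thesis using True by (simp add: hole_set_def)
    next
      case False
      show ?thesis
      proof (rule ccontr)
        assume c: "x \<notin> hole_set W K \<union> {z' 1 2, z' 1 3, z' 2 3}"
        have "x \<in> D' 1 2 \<union> D' 2 1" "x \<in> D' 1 3 \<union> D' 3 1" "x \<in> D' 2 3 \<union> D' 3 2"
          using D'_cover[of 1 2] D'_cover[of 1 3] D'_cover[of 2 3] c xV by auto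
        moreover have "\<not> (\<forall>j\<in>{1..3}-{i}. x \<in> D' i j)" if "i \<in> {1..3}" for i
          using nK[OF that] all_coord_eq[OF that] False xV unfolding K'_def by blast
        from this[of 1] this[of 2] this[of 3]
        have "\<not> (x \<in> D' 1 2 \<and> x \<in> D' 1 3)" "\<not> (x \<in> D' 2 1 \<and> x \<in> D' 2 3)"
          "\<not> (x \<in> D' 3 1 \<and> x \<in> D' 3 2)"
          by (auto simp: atLeastAtMost_1_3 insert_Diff_if)
        ultimately have "x \<in> D' 1 2 \<and> x \<in> D' 2 3 \<and> x \<in> D' 3 1 \<or> x \<in> D' 2 1 \<and> x \<in> D' 3 2 \<and> x \<in> D' 1 3"
          by blast
        \<comment> \<open>A cycle of weak inequalities is a chain of equalities, which places
          \<open>x\<close> in \<open>W\<close>.\<close>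
        then have "coord 2 x = coord 1 x \<and> coord 3 x = coord 1 x"
          using D'_coord_le[of x 1 2] D'_coord_le[of x 2 3] D'_coord_le[of x 3 1]
            D'_coord_le[of x 2 1] D'_coord_le[of x 3 2] D'_coord_le[of x 1 3] by auto
        then show False using False all_coord_eq[of 1] xV by (simp add: atLeastAtMost_1_3)
      qed
    qed
  qed
  show "hole_set W K \<union> {z' 1 2, z' 1 3, z' 2 3} \<subseteq> hole_set V K'"
  proof -
    have old: "x \<in> hole_set V K'" if x: "x \<in> hole_set W K" for x
    proof -
      have xW: "x \<in> W" using x by (simp add: hole_set_def)
      have "x \<notin> K' i" if i: "i \<in> {1..3}" for i
      proof
        assume "x \<in> K' i"
        moreover have "\<forall>j\<in>{1..3}. coord j x = coord i x" using xW by (simp add: coord_W)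
        ultimately have "x \<in> K i" unfolding K'_def by blast
        then show False using x i unfolding hole_set_def by blast
      qed
      then show ?thesis using xW W by (simp add: hole_set_def)
    qed
    have new: "z' i j \<in> hole_set V K'"
      if ij: "i \<in> {1..3}" "j \<in> {1..3}" "i \<noteq> j" and k: "k = 6 - (i + j)" "{1..3} = {i, j, k}" "i \<noteq> k" for i j k
    proof -
      have zz: "z' j i = z' i j" using cut_systemD(7)[OF sys ij] by (simp add: z'_def add.commute)
      have "z' i j \<notin> D' i j" "z' i j \<notin> D' j i"
        using z'_notin[OF ij] z'_notin[OF ij(2,1)] ij(3) zz by auto
      then have "z' i j \<notin> K' i" "z' i j \<notin> K' j" using ij unfolding K'_def by blast+
      \<comment> \<open>The height 1 is positive, so \<open>z' i j\<close> is outside sector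
        \<open>k\<close>; the other two sets miss it because it is on neither side of their
        cut.\<close>
      moreover have "coord k (z' i j) < coord i (z' i j)"
        using z'_props(4)[OF ij] k(1) by (simp add: height_def)
      then have "z' i j \<notin> K' k" using K'_coord_le[of "z' i j" k i] ij(1) by auto
      ultimately show ?thesis using z'_props(1)[OF ij] unfolding hole_set_def k(2) by blast
    qed
    have "z' 1 2 \<in> hole_set V K'" by (rule new[of 1 2 3]) auto
    moreover have "z' 1 3 \<in> hole_set V K'" by (rule new[of 1 3 2]) auto
    moreover have "z' 2 3 \<in> hole_set V K'" by (rule new[of 2 3 1]) auto
    ultimately show ?thesis using old by blast
  qed
qed

text \<open>In the plane of \<open>e1\<close> and \<open>e2\<close> the new points are (1,1), (0,-1)
  and (-1,0), while every old hole sits at the origin.\<close>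

lemma card_hole_set_step:
  assumes "finite (hole_set W K)"
  shows "finite (hole_set V K')" "card (hole_set V K') = card (hole_set W K) + 3"
proof -
  have "coord 1 (z' 1 2) = 1" "coord 2 (z' 1 2) = 1" "coord 1 (z' 1 3) = 0" "coord 2 (z' 1 3) = -1"
    "coord 1 (z' 2 3) = -1" "coord 2 (z' 2 3) = 0"
    using zW by (simp_all add: coord_def z'_def ray_def inner_add_right inner_diff_right)
  moreover have "coord i x = 0" if "x \<in> hole_set W K" for i x using that coord_W by (simp add: hole_set_def)
  ultimately have "card {z' 1 2, z' 1 3, z' 2 3} = 3" "hole_set W K \<inter> {z' 1 2, z' 1 3, z' 2 3} = {}"
    by (force simp: card_insert_if)+
  then show "card (hole_set V K') = card (hole_set W K) + 3"
    unfolding hole_set_step using assms by (subst card_Un_disjoint) auto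
  show "finite (hole_set V K')" unfolding hole_set_step using assms by simp
qed

end

section \<open>Induction for the construction and the final theorem\<close>

lemma orthonormal_pair:
  fixes V :: "'a::euclidean_space set"
  assumes V: "subspace V" and d: "dim V = Suc (Suc d)"
  obtains e1 e2 where "norm e1 = 1" "norm e2 = 1" "e1 \<bullet> e2 = 0" "e1 \<in> V" "e2 \<in> V"
    "subspace {x\<in>V. e1 \<bullet> x = 0 \<and> e2 \<bullet> x = 0}" "dim {x\<in>V. e1 \<bullet> x = 0 \<and> e2 \<bullet> x = 0} = d"
proof -
  obtain B where B: "B \<subseteq> V" "pairwise orthogonal B" "\<And>x. x \<in> B \<Longrightarrow> norm x = 1"
    "independent B" "card B = dim V" "span B = V"
    by (rule orthonormal_basis_subspace[OF V]) blast
  obtain B' where "B' \<subseteq> B" "card B' = 2"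
    using obtain_subset_with_card_n[of 2 B] B(5) d by auto
  then obtain e1 e2 where e: "e1 \<in> B" "e2 \<in> B" "e1 \<noteq> e2"
    by (auto simp: card_2_iff)
  then have o: "e1 \<bullet> e2 = 0" using B(2) by (auto simp: pairwise_def orthogonal_def)
  have eV: "e1 \<in> V" "e2 \<in> V" using e B by auto
  let ?W = "{x\<in>V. e1 \<bullet> x = 0 \<and> e2 \<bullet> x = 0}"
  have W: "?W = {y\<in>V. \<forall>x\<in>span {e1, e2}. orthogonal x y}"
  proof -
    have "(\<forall>x\<in>span {e1, e2}. orthogonal x y) \<longleftrightarrow> e1 \<bullet> y = 0 \<and> e2 \<bullet> y = 0" for y
    proof
      assume "e1 \<bullet> y = 0 \<and> e2 \<bullet> y = 0"
      then have "orthogonal y x" if "x \<in> span {e1, e2}" for x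
        using that by (intro orthogonal_to_span[of x "{e1, e2}"]) (auto simp: orthogonal_def inner_commute)
      then show "\<forall>x\<in>span {e1, e2}. orthogonal x y" by (simp add: orthogonal_commute)
    qed (auto simp: orthogonal_def span_base)
    then show ?thesis by blast
  qed
  have sub: "subspace ?W" using V by (auto simp: subspace_def inner_add_right)
  have sV: "span {e1, e2} \<subseteq> V" using eV V by (simp add: span_minimal)
  have ind: "independent {e1, e2}" using e independent_mono[OF B(4)] by auto
  have "dim {y\<in>V. \<forall>x\<in>span {e1, e2}. orthogonal x y} + dim (span {e1, e2}) = dim V"
    by (rule dim_subspace_orthogonal_to_vectors[OF subspace_span V sV])
  moreover have "dim (span {e1, e2}) = 2"
    using dim_span_eq_card_independent[OF ind] e(3) by simp
  ultimately have "dim ?W = d" using d W by simp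
  then show ?thesis using that[of e1 e2] B e o eV sub by blast
qed

text \<open>Orthogonal complements remain subspaces of the same ambient type, so the induction can
  run over \<open>V\<close>.\<close>

lemma cut_system_exists:
  fixes V :: "'a::euclidean_space set"
  assumes "subspace V" "dim V = d"
  shows "\<exists>K D z. cut_system V K D z \<and> finite (hole_set V K) \<and> card (hole_set V K) = max_encapsulated d"
  using assms
proof (induction d arbitrary: V rule: less_induct)
  case (less d)
  consider "d = 0" | "d = 1" | e where "d = Suc (Suc e)"
    by (metis One_nat_def not0_implies_Suc)
  then show ?case
  proof cases
    case 1
    then have "V = {0}" using less.prems by (metis dim_eq_0 subspace_0 subset_singletonD empty_iff)
    moreover have "hole_set {0} (\<lambda>_. {}) = {0::'a}" by (auto simp: hole_set_def)
    ultimately show ?thesis using cut_system_0 1 by fastforce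
  next
    case 2
    obtain B where B: "B \<subseteq> V" "pairwise orthogonal B" "\<And>x. x \<in> B \<Longrightarrow> norm x = 1"
      "independent B" "card B = dim V" "span B = V"
      by (rule orthonormal_basis_subspace[OF less.prems(1)]) blast
    then obtain e where e: "B = {e}" using less.prems 2 card_1_singletonE by metis
    then have ne: "norm e = 1" using B by auto
    have Ve: "span {e} = V" using B(6) e by simp
    obtain K D z where K: "cut_system V K D z" "hole_set V K = {0, e}"
      by (rule cut_system_1[OF ne]) (simp add: Ve)
    have "e \<noteq> 0" using ne by auto
    then have "finite (hole_set V K) \<and> card (hole_set V K) = max_encapsulated d" using K(2) 2 by simp
    then show ?thesis using K by blast
  next
    case (3 c)
    obtain e1 e2 where e: "norm e1 = 1" "norm e2 = 1" "e1 \<bullet> e2 = 0" "e1 \<in> V" "e2 \<in> V"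
      "subspace {x\<in>V. e1 \<bullet> x = 0 \<and> e2 \<bullet> x = 0}" "dim {x\<in>V. e1 \<bullet> x = 0 \<and> e2 \<bullet> x = 0} = c"
      by (rule orthonormal_pair[OF less.prems(1), of c]) (simp add: less.prems(2) 3)
    define W where "W = {x\<in>V. e1 \<bullet> x = 0 \<and> e2 \<bullet> x = 0}"
    obtain K D z where K: "cut_system W K D z" "finite (hole_set W K)"
      "card (hole_set W K) = max_encapsulated c"
      using less.IH[of c W] e(6,7) 3 unfolding W_def by auto
    interpret cut_system_step V W e1 e2 K D z
      by unfold_locales (fact less.prems(1) e(1-5) W_def K(1))+
    show ?thesis
      using cut_system_step card_hole_set_step[OF K(2)] K(3) 3 by auto
  qed
qed

theorem theorem1p2:
  fixes V :: "'a::euclidean_space set" and d :: nat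
  assumes "subspace V" and "dim V = d"
  shows "(\<forall>K. convex_sets_in V 3 K \<longrightarrow>
            finite (encapsulated_points V 3 K) \<and>
            card (encapsulated_points V 3 K) \<le> max_encapsulated d)
       \<and> (\<forall>K. convex_sets_in V 3 K \<longrightarrow>
            card (encapsulated_points V 3 K) = max_encapsulated d \<longrightarrow>
            disjoint_family_on K {1..3})
       \<and> (\<exists>K. convex_sets_in V 3 K \<and>
            finite (encapsulated_points V 3 K) \<and>
            card (encapsulated_points V 3 K) = max_encapsulated d \<and>
            V - (\<Union>i\<in>{1..3}. K i) = encapsulated_points V 3 K)"
proof (intro conjI allI impI)
  have V: "affine V" "aff_dim V \<le> int d"
    using assms by (simp_all add: subspace_imp_affine aff_dim_subspace)
  fix K :: "nat \<Rightarrow> 'a set" assume K: "convex_sets_in V 3 K"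
  then have "\<forall>i\<in>{1..3}. convex (K i)" by (simp add: convex_sets_in_def)
  note bound = encapsulated_points_bound[OF this V]
  show "finite (encapsulated_points V 3 K)" "card (encapsulated_points V 3 K) \<le> max_encapsulated d"
    using bound by auto
  assume "card (encapsulated_points V 3 K) = max_encapsulated d"
  then have "disjoint_family_on (\<lambda>i. K i \<inter> V) {1..3}" using bound by auto
  moreover have "K i \<inter> V = K i" if "i \<in> {1..3}" for i
    using K that unfolding convex_sets_in_def by blast
  ultimately show "disjoint_family_on K {1..3}" unfolding disjoint_family_on_def by simp
next
  obtain K D z where K: "cut_system V K D z" "finite (hole_set V K)" "card (hole_set V K) = max_encapsulated d"
    using cut_system_exists[OF assms] by blast
  have "encapsulated_points V 3 K = hole_set V K"
    using encapsulated_points_eq_complement[where V = V and n = 3 and K = K] K(2) by (simp add: hole_set_def)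
  moreover have "convex_sets_in V 3 K"
    using cut_systemD(1,2)[OF K(1)] by (simp add: convex_sets_in_def)
  ultimately show "\<exists>K. convex_sets_in V 3 K \<and>
            finite (encapsulated_points V 3 K) \<and>
            card (encapsulated_points V 3 K) = max_encapsulated d \<and>
            V - (\<Union>i\<in>{1..3}. K i) = encapsulated_points V 3 K"
    using K(2,3) by (intro exI[of _ K]) (simp add: hole_set_def)
qed

end
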